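(* Let $m_n$ denote the length of the smallest interval after $n$ steps of Kakutani's interval-splitting process. There exists a constant $C\in[0,\infty)$ such that for every $n\in\mathbb N$, \[ \sup_{x\in[0,\infty)}\left|\Pr\left(\frac{n^2 m_n}{2}>x\right)-e^{-x}\right|\le \frac{C(1+\log n)}{\sqrt n}. \]
   Context: Kakutani's interval-splitting process: let $U_1,U_2,\dots$ be i.i.d. uniform random variables on $[0,1]$. At time $0$ the partition of $[0,1]$ consists of the single interval $[0,1]$. Given the partition at time $n\in\mathbb Z_+$ (which consists of $n+1$ intervals, whose lengths are a.s. distinct), let $[a,b]$ be the interval of maximal length; the partition at time $n+1$ is obtained by replacing $[a,b]$ by the two intervals $[a,a+U_{n+1}(b-a)]$ and $[a+U_{n+1}(b-a),b]$. Write $L_{n,1},\dots,L_{n,n+1}$ for the lengths of the $n+1$ intervals at time $n$ (in left-to-right order), $M_n:=\max_i L_{n,i}$ and $m_n:=\min_i L_{n,i}$. *)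

theory Defs
  imports "HOL-Probability.Probability"
begin

text \<open>Kakutani's interval-splitting process, driven by a deterministic sequence
  u :: nat => real; u n plays the role of U_(n+1).  The partition at time n is
  the list of intervals (a,b) in left-to-right order.\<close>

definition ilen :: "real \<times> real \<Rightarrow> real" where
  "ilen I = snd I - fst I"

definition max_idx :: "(real \<times> real) list \<Rightarrow> nat" where
  "max_idx Is = (LEAST j. j < length Is \<and> (\<forall>k<length Is. ilen (Is ! k) \<le> ilen (Is ! j)))"

fun kakutani :: "(nat \<Rightarrow> real) \<Rightarrow> nat \<Rightarrow> (real \<times> real) list" where
  "kakutani u 0 = [(0, 1)]"
| "kakutani u (Suc n) =
     (let Is = kakutani u n; j = max_idx Is; a = fst (Is ! j); b = snd (Is ! j);
          c = a + u n * (b - a)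
      in take j Is @ [(a, c), (c, b)] @ drop (Suc j) Is)"

definition kak_lengths :: "(nat \<Rightarrow> real) \<Rightarrow> nat \<Rightarrow> real list" where
  "kak_lengths u n = map ilen (kakutani u n)"

definition kak_min :: "(nat \<Rightarrow> real) \<Rightarrow> nat \<Rightarrow> real" where
  "kak_min u n = Min (set (kak_lengths u n))"

definition unif_seq :: "(nat \<Rightarrow> real) measure" where
  "unif_seq = (\<Pi>\<^sub>M i\<in>(UNIV :: nat set). uniform_measure lborel {0..1::real})"

end

theory Submission
  imports Defs
begin

text \<open>
  Let \<open>M\<^sub>k\<close> be the longest interval at time \<open>k\<close> and \<open>m\<^sub>k\<close> the shortest. The event \<open>m\<^sub>n > d\<close> means that
  every split produces two fragments longer than \<open>d\<close>, which given the past has probability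
  \<open>(1 - 2d/M\<^sub>k)\<^sup>+\<close> at step \<open>k\<close>. Replacing \<open>2/M\<^sub>k\<close> by \<open>k + 1/2\<close> and \<open>1 - p\<close> by \<open>exp (-p)\<close> turns the
  product of these probabilities into \<open>exp (-d n\<^sup>2/2)\<close>, and a telescoping sum bounds the error by
  \<open>d\<close> times the sum of the expectations of \<open>\<bar>2/M\<^sub>k - (k + 1)\<bar>\<close>, up to lower-order terms.

  These expectations are of order \<open>sqrt k\<close>. For fixed \<open>t < 1\<close>, add up \<open>2 l/t - 1\<close> over all fragments of
  length \<open>l \<le> t\<close> produced while the longest interval exceeds \<open>t\<close>. This is a martingale with
  increments bounded by 2, so its variance at time \<open>k\<close> is at most \<open>4 k\<close>. As the lengths sum to 1, it is
  at least \<open>2/t - (k + 1)\<close> if \<open>M\<^sub>k \<le> t\<close> and at most \<open>2/t - (k + 2)\<close> otherwise, so Chebyshev's inequality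
  controls both tails of \<open>M\<^sub>k\<close>.

  With \<open>d = 2 x/n\<^sup>2\<close> the error is of order \<open>x / sqrt n\<close>. This suffices for \<open>x \<le> ln n\<close>; larger \<open>x\<close> follow by
  monotonicity, since \<open>exp (- ln n) = 1/n\<close>.
\<close>

section \<open>Deterministic properties of the process\<close>

definition kak_max :: "(nat \<Rightarrow> real) \<Rightarrow> nat \<Rightarrow> real" where
  "kak_max u n = ilen (kakutani u n ! max_idx (kakutani u n))"

text \<open>The longest interval is close to twice the mean length 1/(k+1). The comparison is made
  between reciprocals because the probability that a split leaves a fragment of length at most
  \<open>d\<close> is linear in \<open>1 / kak_max u k\<close> as long as it is below 1.\<close>

definition kak_dev :: "(nat \<Rightarrow> real) \<Rightarrow> nat \<Rightarrow> real" where
  "kak_dev u k = 2 / kak_max u k - real (k + 1)"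

lemma ex_max_idx:
  assumes "Is \<noteq> []"
  shows "\<exists>j < length Is. \<forall>k<length Is. ilen (Is ! k) \<le> ilen (Is ! j)"
proof -
  let ?A = "(\<lambda>k. ilen (Is ! k)) ` {..<length Is}"
  have A: "finite ?A" "?A \<noteq> {}" using assms by auto
  from Max_in[OF A] obtain j where j: "j < length Is" "ilen (Is ! j) = Max ?A" by auto
  show ?thesis
    using j Max_ge[OF A(1)] by (intro exI[of _ j]) auto
qed

lemma
  assumes "Is \<noteq> []"
  shows max_idx_less: "max_idx Is < length Is"
    and ilen_le_max_idx: "k < length Is \<Longrightarrow> ilen (Is ! k) \<le> ilen (Is ! max_idx Is)"
proof -
  have "max_idx Is < length Is \<and> (\<forall>k<length Is. ilen (Is ! k) \<le> ilen (Is ! max_idx Is))"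
    unfolding max_idx_def using ex_max_idx[OF assms] by (rule LeastI_ex)
  then show "max_idx Is < length Is"
    and "k < length Is \<Longrightarrow> ilen (Is ! k) \<le> ilen (Is ! max_idx Is)" by auto
qed

lemma length_kakutani [simp]: "length (kakutani u n) = Suc n"
proof (induction n)
  case (Suc n)
  have "kakutani u n \<noteq> []" using Suc by auto
  from max_idx_less[OF this] show ?case using Suc by (simp add: Let_def)
qed simp

declare kakutani.simps(2) [simp del]

lemma kakutani_nonempty [simp]: "kakutani u n \<noteq> []"
  using length_kakutani[of u n] by (metis list.size(3) nat.distinct(1))

lemma max_idx_kakutani_less: "max_idx (kakutani u n) < Suc n"
  using max_idx_less[of "kakutani u n"] by simp

text \<open>Adaptedness: this is what later makes coordinate \<open>n\<close> independent of
  everything built up to time \<open>n\<close>.\<close>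

lemma kakutani_cong: "(\<And>i. i < n \<Longrightarrow> u i = v i) \<Longrightarrow> kakutani u n = kakutani v n"
  by (induction n) (simp_all add: kakutani.simps(2) Let_def)

lemma kak_max_cong: "(\<And>i. i < n \<Longrightarrow> u i = v i) \<Longrightarrow> kak_max u n = kak_max v n"
  unfolding kak_max_def using kakutani_cong[of n u v] by simp

section \<open>Interval lengths and the effect of one split on them\<close>

lemma length_kak_lengths [simp]: "length (kak_lengths u n) = Suc n"
  by (simp add: kak_lengths_def)

lemma kak_lengths_0 [simp]: "kak_lengths u 0 = [1]"
  by (simp add: kak_lengths_def ilen_def)

text \<open>Outside the measurability proofs a split is used in this form only: endpoints and the
  index of the longest interval are forgotten, and the surrounding lengths stay fixed.\<close>

lemma kak_lengths_Suc:
  obtains xs ys where "kak_lengths u n = xs @ [kak_max u n] @ ys"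
    and "kak_lengths u (Suc n) = xs @ [u n * kak_max u n, (1 - u n) * kak_max u n] @ ys"
proof
  let ?I = "kakutani u n" and ?j = "max_idx (kakutani u n)"
  have j: "?j < length ?I" by (rule max_idx_less) simp
  show "kak_lengths u n = map ilen (take ?j ?I) @ [kak_max u n] @ map ilen (drop (Suc ?j) ?I)"
    unfolding kak_lengths_def kak_max_def by (subst id_take_nth_drop[OF j]) simp
  show "kak_lengths u (Suc n) = map ilen (take ?j ?I) @
    [u n * kak_max u n, (1 - u n) * kak_max u n] @ map ilen (drop (Suc ?j) ?I)"
    by (simp add: kak_lengths_def kak_max_def kakutani.simps(2) Let_def ilen_def algebra_simps)
qed

lemma kak_max_in: "kak_max u n \<in> set (kak_lengths u n)"
  by (rule kak_lengths_Suc[of u n]) auto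

lemma kak_max_ge: "l \<in> set (kak_lengths u n) \<Longrightarrow> l \<le> kak_max u n"
proof -
  assume "l \<in> set (kak_lengths u n)"
  then obtain i where "i < Suc n" "l = ilen (kakutani u n ! i)"
    by (auto simp: in_set_conv_nth kak_lengths_def simp del: length_kak_lengths)
  then show ?thesis
    using ilen_le_max_idx[of "kakutani u n" i] by (simp add: kak_max_def)
qed

lemma sum_list_kak_lengths_Suc:
  "(\<Sum>l\<leftarrow>kak_lengths u (Suc n). f l) = (\<Sum>l\<leftarrow>kak_lengths u n. f l) - f (kak_max u n)
     + f (u n * kak_max u n) + f ((1 - u n) * kak_max u n)"
  for f :: "real \<Rightarrow> real"
  by (rule kak_lengths_Suc[of u n]) simp

lemma sum_kak_lengths: "sum_list (kak_lengths u n) = 1"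
proof (induction n)
  case (Suc n)
  then show ?case
    using sum_list_kak_lengths_Suc[of "\<lambda>l. l" u n] by (simp add: algebra_simps)
qed simp

text \<open>A maximum is at least the mean, and the mean length is 1/(n+1) for every real sequence
  \<open>u\<close>. Hence positivity of the maximum and the bound on \<open>kak_dev\<close> hold
  everywhere, not just almost everywhere.\<close>

lemma kak_max_lower: "1 \<le> real (n + 1) * kak_max u n"
proof -
  have "sum_list (kak_lengths u n) \<le> (\<Sum>l\<leftarrow>kak_lengths u n. kak_max u n)"
    using sum_list_mono[of "kak_lengths u n" "\<lambda>l. l" "\<lambda>l. kak_max u n"] kak_max_ge by simp
  then show ?thesis by (simp add: sum_kak_lengths sum_list_triv)
qed

lemma kak_max_pos: "0 < kak_max u n"
  using kak_max_lower[of n u] mult_nonneg_nonpos[of "real (n + 1)" "kak_max u n"] by linarith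

lemma kak_dev_bound: "\<bar>kak_dev u k\<bar> \<le> real (k + 1)"
proof -
  have "2 / kak_max u k \<le> 2 * real (k + 1)"
    using kak_max_lower[of k u] kak_max_pos[of u k] by (simp add: field_simps)
  moreover have "0 < 2 / kak_max u k" using kak_max_pos[of u k] by simp
  ultimately show ?thesis by (simp add: kak_dev_def abs_le_iff)
qed

lemma kak_lengths_nonneg:
  assumes "\<forall>i. 0 \<le> u i \<and> u i \<le> 1" and "l \<in> set (kak_lengths u n)"
  shows "0 \<le> l"
  using assms(2)
proof (induction n arbitrary: l)
  case (Suc n)
  show ?case
    using Suc assms(1)[rule_format, of n] kak_max_pos[of u n]
    by (rule_tac kak_lengths_Suc[of u n]) (auto intro: mult_nonneg_nonneg)
qed simp

lemma kak_max_Suc_le: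
  assumes "\<forall>i. 0 \<le> u i \<and> u i \<le> 1"
  shows "kak_max u (Suc n) \<le> kak_max u n"
proof -
  have "l \<le> kak_max u n" if "l \<in> set (kak_lengths u (Suc n))" for l
  proof (rule kak_lengths_Suc[of u n])
    fix xs ys
    assume *: "kak_lengths u n = xs @ [kak_max u n] @ ys"
      "kak_lengths u (Suc n) = xs @ [u n * kak_max u n, (1 - u n) * kak_max u n] @ ys"
    have "u n * kak_max u n \<le> kak_max u n" "(1 - u n) * kak_max u n \<le> kak_max u n"
      using assms[rule_format, of n] kak_max_pos[of u n] by (auto simp: mult_le_cancel_right1)
    then show ?thesis using that * kak_max_ge[of l u n] by auto
  qed
  then show ?thesis using kak_max_in by blast
qed

lemma kak_max_le_1:
  assumes "\<forall>i. 0 \<le> u i \<and> u i \<le> 1"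
  shows "kak_max u n \<le> 1"
proof (induction n)
  case 0
  then show ?case using kak_max_in[of u 0] by simp
next
  case (Suc n)
  then show ?case using kak_max_Suc_le[OF assms, of n] by simp
qed

lemma kak_min_gt_iff: "kak_min u n > d \<longleftrightarrow> (\<forall>l\<in>set (kak_lengths u n). d < l)"
  unfolding kak_min_def by (rule Min_gr_iff) (auto simp: kak_lengths_def)

text \<open>Two fragments longer than \<open>d\<close> add up to more than 2d \<ge> d, so the
  interval that disappears in the split was itself longer than \<open>d\<close>.\<close>

lemma kak_min_gt_Suc:
  assumes "0 \<le> d"
  shows "kak_min u (Suc n) > d \<longleftrightarrow>
    kak_min u n > d \<and> d < u n * kak_max u n \<and> d < (1 - u n) * kak_max u n"
proof (rule kak_lengths_Suc[of u n])
  fix xs ys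
  assume *: "kak_lengths u n = xs @ [kak_max u n] @ ys"
    "kak_lengths u (Suc n) = xs @ [u n * kak_max u n, (1 - u n) * kak_max u n] @ ys"
  have "d < u n * kak_max u n \<Longrightarrow> d < (1 - u n) * kak_max u n \<Longrightarrow> d < kak_max u n"
    using assms by (simp add: algebra_simps)
  then show ?thesis unfolding kak_min_gt_iff * by auto
qed

section \<open>The centred fragment score\<close>

text \<open>A uniform split of an interval longer than \<open>t\<close> yields a fragment that, given that its length
  is at most \<open>t\<close>, has length uniform on \<open>[0, t]\<close>; hence its \<open>frag_score\<close> has mean zero.\<close>

definition frag_score :: "real \<Rightarrow> real \<Rightarrow> real" where
  "frag_score t l = (if 0 \<le> l \<and> l \<le> t then 2 * l / t - 1 else 0)"

text \<open>The value 0 for m \<le> t freezes the sum \<open>kak_mart\<close> once the longest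
  interval has dropped to \<open>t\<close>, as a stopping time would.\<close>

definition split_score :: "real \<Rightarrow> real \<Rightarrow> real \<Rightarrow> real" where
  "split_score t m v = (if m > t then frag_score t (v * m) + frag_score t ((1 - v) * m) else 0)"

fun kak_mart :: "real \<Rightarrow> (nat \<Rightarrow> real) \<Rightarrow> nat \<Rightarrow> real" where
  "kak_mart t u 0 = 0"
| "kak_mart t u (Suc k) = kak_mart t u k + split_score t (kak_max u k) (u k)"

lemma kak_mart_cong: "(\<And>i. i < n \<Longrightarrow> u i = v i) \<Longrightarrow> kak_mart t u n = kak_mart t v n"
proof (induction n)
  case (Suc n)
  then show ?case using kak_max_cong[of n u v] by simp
qed simp

lemma frag_score_bound: "0 < t \<Longrightarrow> \<bar>frag_score t l\<bar> \<le> 1"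
  by (auto simp: frag_score_def abs_le_iff field_simps)

lemma split_score_bound: "0 < t \<Longrightarrow> \<bar>split_score t m v\<bar> \<le> 2"
  using frag_score_bound[of t "v * m"] frag_score_bound[of t "(1 - v) * m"]
  by (auto simp: split_score_def)

lemma kak_mart_bound: "0 < t \<Longrightarrow> \<bar>kak_mart t u n\<bar> \<le> 2 * real n"
proof (induction n)
  case (Suc n)
  then show ?case using split_score_bound[of t "kak_max u n" "u n"] by simp
qed simp

text \<open>A length l > t scores 0, whereas 2l/t - 1 is positive there; for 0 \<le> l \<le> t both
  agree.\<close>

lemma frag_scores_le:
  assumes "0 < t" "\<And>l. l \<in> set ls \<Longrightarrow> (0::real) \<le> l"
  shows "(\<Sum>l\<leftarrow>ls. frag_score t l) \<le> 2 * sum_list ls / t - real (length ls)"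
  using assms(2)
proof (induction ls)
  case (Cons l ls)
  have "frag_score t l \<le> 2 * l / t - 1"
    using Cons.prems assms(1) by (auto simp: frag_score_def field_simps)
  with Cons show ?case by (simp add: add_divide_distrib algebra_simps)
qed simp

lemma frag_scores_eq:
  assumes "0 < t" "\<And>l. l \<in> set ls \<Longrightarrow> 0 \<le> l \<and> l \<le> t"
  shows "(\<Sum>l\<leftarrow>ls. frag_score t l) = 2 * sum_list ls / t - real (length ls)"
  using assms(2)
  by (induction ls) (simp_all add: frag_score_def add_divide_distrib algebra_simps)

text \<open>The longest interval scores 0, and the other \<open>n\<close> have total length below 1
  - t.\<close>

lemma frag_scores_kak_le:
  assumes "0 < t" "\<forall>i. 0 \<le> u i \<and> u i \<le> 1" "t < kak_max u n"
  shows "(\<Sum>l\<leftarrow>kak_lengths u n. frag_score t l) \<le> 2 / t - 2 - real n"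
proof (rule kak_lengths_Suc[of u n])
  fix xs ys
  assume *: "kak_lengths u n = xs @ [kak_max u n] @ ys"
  have nn: "0 \<le> l" if "l \<in> set xs \<union> set ys" for l
    using kak_lengths_nonneg[OF assms(2), of l n] that unfolding * by auto
  have "(\<Sum>l\<leftarrow>xs @ ys. frag_score t l) \<le> 2 * sum_list (xs @ ys) / t - real (length (xs @ ys))"
    by (rule frag_scores_le) (use nn assms(1) in auto)
  moreover have "sum_list (xs @ ys) = 1 - kak_max u n" 
    using sum_kak_lengths[of u n] unfolding * by simp
  moreover have "length (xs @ ys) = n"
    using length_kak_lengths[of u n] unfolding * by simp
  moreover have "2 * (1 - kak_max u n) / t \<le> 2 / t - 2"
    using assms by (simp add: field_simps)
  ultimately have "(\<Sum>l\<leftarrow>xs @ ys. frag_score t l) \<le> 2 / t - 2 - real n"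
    by (smt (verit))
  moreover have "frag_score t (kak_max u n) = 0" using assms(3) by (simp add: frag_score_def)
  ultimately show ?thesis unfolding * by simp
qed

text \<open>While the maximum exceeds \<open>t\<close>, the interval being split has score 0, so no
  score is ever lost and the martingale equals the total score of the current lengths. When the
  maximum first drops to \<open>t\<close>, all n + 1 lengths count and the total is exactly 2/t -
  (n+1). Afterwards the martingale is frozen while the bound decreases in \<open>n\<close>.\<close>

lemma kak_mart_dichotomy:
  assumes t: "0 < t" "t < 1" and u: "\<forall>i. 0 \<le> u i \<and> u i \<le> 1"
  shows "(t < kak_max u n \<longrightarrow> kak_mart t u n = (\<Sum>l\<leftarrow>kak_lengths u n. frag_score t l)) \<and>
    (kak_max u n \<le> t \<longrightarrow> 2 / t - 1 - real n \<le> kak_mart t u n)"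
proof (induction n)
  case 0
  have "kak_max u 0 = 1" using kak_max_in[of u 0] by simp
  then show ?case using t by (simp add: frag_score_def)
next
  case (Suc n)
  show ?case
  proof (cases "t < kak_max u n")
    case True
    have eq: "kak_mart t u (Suc n) = (\<Sum>l\<leftarrow>kak_lengths u (Suc n). frag_score t l)"
      using Suc True unfolding sum_list_kak_lengths_Suc
      by (simp add: split_score_def frag_score_def[of t "kak_max u n"])
    have "kak_mart t u (Suc n) = 2 / t - 1 - real (Suc n)" if le: "kak_max u (Suc n) \<le> t"
    proof -
      have "0 \<le> l \<and> l \<le> t" if "l \<in> set (kak_lengths u (Suc n))" for l
        using kak_lengths_nonneg[OF u that] kak_max_ge[OF that] le by simp
      from frag_scores_eq[OF t(1) this] show ?thesis
        unfolding eq by (simp add: sum_kak_lengths)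
    qed
    then show ?thesis using eq by simp
  next
    case False
    then show ?thesis using Suc kak_max_Suc_le[OF u, of n] by (simp add: split_score_def)
  qed
qed

section \<open>The driving sequence and measurability\<close>

abbreviation unif01 :: "real measure" where
  "unif01 \<equiv> uniform_measure lborel {0..1}"

lemma unif01_eq_density: "unif01 = density lborel (\<lambda>x. ennreal (indicator {0..1} x))"
  unfolding uniform_measure_def by (intro arg_cong[where f="density lborel"]) (auto simp: fun_eq_iff indicator_def)

interpretation U: prob_space unif01
  by (rule prob_space_uniform_measure) auto

interpretation S: sequence_space unif01
  by unfold_locales

interpretation P: prob_space unif_seq
  unfolding unif_seq_def by unfold_locales

lemma space_unif_seq [simp]: "space unif_seq = UNIV"
  by (simp add: unif_seq_def space_PiM)

lemma coord_measurable: "(\<lambda>u. u n) \<in> borel_measurable unif_seq"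
proof -
  have "(\<lambda>u. u n) \<in> measurable unif_seq unif01"
    unfolding unif_seq_def by simp
  then show ?thesis by (simp cong: measurable_cong_sets)
qed

lemma AE_unif_seq: "AE u in unif_seq. \<forall>i. 0 \<le> u i \<and> u i \<le> 1"
proof -
  have "AE x in unif01. 0 \<le> x \<and> x \<le> 1"
    by (rule AE_uniform_measureI) auto
  then have "AE u in unif_seq. 0 \<le> u i \<and> u i \<le> 1" for i
    unfolding unif_seq_def by (intro AE_PiM_component) (auto intro: U.prob_space_axioms)
  then show ?thesis by (simp add: AE_all_countable)
qed

text \<open>Conditioning on the first \<open>n\<close> coordinates, by Fubini: gluing the first
  \<open>n\<close> terms of \<open>w\<close> to an independent sequence \<open>w'\<close> preserves
  the law, coordinate \<open>n\<close> of the result is \<open>w' 0\<close>, and \<open>F\<close>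
  sees only the first \<open>n\<close> terms of \<open>w\<close>.\<close>

lemma expectation_next_coordinate:
  fixes F :: "(nat \<Rightarrow> real) \<Rightarrow> real \<Rightarrow> real"
  assumes F [measurable]: "(\<lambda>(u, v). F u v) \<in> borel_measurable (unif_seq \<Otimes>\<^sub>M borel)"
    and bound: "\<And>u v. \<bar>F u v\<bar> \<le> B"
    and cong: "\<And>u u' v. (\<And>i. i < n \<Longrightarrow> u i = u' i) \<Longrightarrow> F u v = F u' v"
  shows "(\<integral>u. F u (u n) \<partial>unif_seq) = (\<integral>u. (\<integral>v. F u v \<partial>unif01) \<partial>unif_seq)"
proof -
  interpret SS: pair_prob_space unif_seq unif_seq ..
  have S: "S.S = unif_seq" by (simp add: unif_seq_def)
  have comb [measurable]: "(\<lambda>(w, w'). comb_seq n w w') \<in> measurable (unif_seq \<Otimes>\<^sub>M unif_seq) unif_seq"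
    unfolding unif_seq_def by (rule measurable_comb_seq)
  have eq: "F (comb_seq n w w') (comb_seq n w w' n) = F w (w' 0)" for w w'
    using cong[of "comb_seq n w w'" w] by (simp add: comb_seq_def)
  have [measurable]: "(\<lambda>u. u n) \<in> borel_measurable unif_seq" for n by (rule coord_measurable)
  have inner: "(\<integral>w'. F w (w' 0) \<partial>unif_seq) = (\<integral>v. F w v \<partial>unif01)" for w
  proof -
    have d: "distr unif_seq unif01 (\<lambda>w'. w' 0) = unif01"
      unfolding unif_seq_def by (rule S.PiM_component) simp
    have [measurable]: "(\<lambda>w'. w' 0) \<in> measurable unif_seq unif01"
      unfolding unif_seq_def by simp
    have "F w \<in> borel_measurable borel"
      using measurable_compose[OF measurable_Pair1'[of w unif_seq borel] F] by simp
    then have "F w \<in> borel_measurable unif01" by (simp cong: measurable_cong_sets)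
    then show ?thesis
      using integral_distr[of "\<lambda>w'. w' 0" unif_seq unif01 "F w"] by (simp add: d)
  qed
  have "(\<integral>u. F u (u n) \<partial>unif_seq) =
      (\<integral>u. F u (u n) \<partial>distr (unif_seq \<Otimes>\<^sub>M unif_seq) unif_seq (\<lambda>(w, w'). comb_seq n w w'))"
    using S.PiM_comb_seq[of n] by (simp add: S)
  also have "\<dots> = (\<integral>(w, w'). F w (w' 0) \<partial>(unif_seq \<Otimes>\<^sub>M unif_seq))"
    by (subst integral_distr) (simp_all add: eq case_prod_beta')
  also have "\<dots> = (\<integral>w. (\<integral>w'. F w (w' 0) \<partial>unif_seq) \<partial>unif_seq)"
  proof (subst SS.integral_fst'[symmetric])
    show "integrable (unif_seq \<Otimes>\<^sub>M unif_seq) (\<lambda>(w, w'). F w (w' 0))"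
      by (rule SS.integrable_const_bound[where B=B]) (auto simp: bound)
  qed simp
  also have "\<dots> = (\<integral>w. (\<integral>v. F w v \<partial>unif01) \<partial>unif_seq)"
    by (simp only: inner)
  finally show ?thesis .
qed

section \<open>Measurability of the partition and of the quantities derived from it\<close>

lemma kakutani_Suc_nth:
  fixes u :: "nat \<Rightarrow> real"
  assumes "i \<le> Suc n"
  defines "I \<equiv> kakutani u n"
  defines "j \<equiv> max_idx I"
  defines "a \<equiv> fst (I ! j)" and "b \<equiv> snd (I ! j)"
  shows "kakutani u (Suc n) ! i =
    (if i < j then I ! i else if i = j then (a, a + u n * (b - a))
     else if i = Suc j then (a + u n * (b - a), b) else I ! (i - 1))"
proof -
  have "j < Suc n" unfolding j_def I_def by (rule max_idx_kakutani_less)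
  moreover have "length I = Suc n" by (simp add: I_def)
  moreover have "kakutani u (Suc n) = take j I @ [(a, a + u n * (b - a)), (a + u n * (b - a), b)] @ drop (Suc j) I"
    by (simp add: I_def j_def a_def b_def kakutani.simps(2) Let_def)
  moreover have "i < j \<or> i = j \<or> i = Suc j \<or> (\<exists>k. i = Suc (Suc (j + k)))"
    by presburger
  ultimately show ?thesis
    using assms(1) by (auto simp: nth_append min_def)
qed

lemma max_idx_kakutani_measurable:
  assumes "\<And>k. k \<le> n \<Longrightarrow> (\<lambda>u. ilen (kakutani u n ! k)) \<in> borel_measurable unif_seq"
  shows "(\<lambda>u. max_idx (kakutani u n)) \<in> measurable unif_seq (count_space UNIV)"
  unfolding max_idx_def length_kakutani
proof (rule measurable_Least)
  fix j
  show "(\<lambda>u. j < Suc n \<and> (\<forall>k<Suc n. ilen (kakutani u n ! k) \<le> ilen (kakutani u n ! j)))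
    \<in> measurable unif_seq (count_space UNIV)"
  proof (cases "j < Suc n")
    case True
    have "Measurable.pred unif_seq (\<lambda>u. \<forall>k\<in>{..<Suc n}. ilen (kakutani u n ! k) \<le> ilen (kakutani u n ! j))"
    proof (rule pred_intros_finite)
      show "Measurable.pred unif_seq (\<lambda>u. ilen (kakutani u n ! k) \<le> ilen (kakutani u n ! j))"
        if "k \<in> {..<Suc n}" for k
        unfolding pred_def by (rule borel_measurable_le; rule assms) (use that True in auto)
    qed (rule finite_lessThan)
    then show ?thesis using True by (simp only: Ball_def lessThan_iff simp_thms)
  qed simp
qed

text \<open>Evaluation at a random index with finitely many values is a finite sum over these
  values.\<close>

lemma nth_at_measurable:
  fixes f :: "'b \<Rightarrow> real"
  assumes "J \<in> measurable unif_seq (count_space UNIV)"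
    and "\<And>u. J u \<le> n"
    and f: "\<And>k. k \<le> n \<Longrightarrow> (\<lambda>u. f (g u ! k)) \<in> borel_measurable unif_seq"
  shows "(\<lambda>u. f (g u ! J u)) \<in> borel_measurable unif_seq"
proof -
  have eq: "(\<lambda>u. f (g u ! J u)) = (\<lambda>u. \<Sum>k\<le>n. if J u = k then f (g u ! k) else 0)"
    using assms(2) by (simp add: fun_eq_iff)
  have "(\<lambda>u. if J u = k then f (g u ! k) else 0) \<in> borel_measurable unif_seq" if "k \<le> n" for k
  proof (rule measurable_If[OF f[OF that]])
    have "J -` {k} \<inter> space unif_seq \<in> sets unif_seq"
      using assms(1) by (rule measurable_sets) simp
    then show "{u \<in> space unif_seq. J u = k} \<in> sets unif_seq"
      by (simp add: vimage_def)
  qed simp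
  then show ?thesis unfolding eq by (intro borel_measurable_sum) simp
qed

text \<open>Both endpoints are treated in one induction, since the split point depends on both ends
  of the chosen interval.\<close>

lemma kakutani_nth_measurable:
  assumes "i \<le> n"
  shows "(\<lambda>u. fst (kakutani u n ! i)) \<in> borel_measurable unif_seq \<and>
    (\<lambda>u. snd (kakutani u n ! i)) \<in> borel_measurable unif_seq"
  using assms
proof (induction n arbitrary: i)
  case 0
  then show ?case by simp
next
  case (Suc n)
  let ?J = "\<lambda>u. max_idx (kakutani u n)"
  let ?a = "\<lambda>u. fst (kakutani u n ! ?J u)" and ?b = "\<lambda>u. snd (kakutani u n ! ?J u)"
  have J: "?J \<in> measurable unif_seq (count_space UNIV)"
  proof (rule max_idx_kakutani_measurable)
    show "(\<lambda>u. ilen (kakutani u n ! k)) \<in> borel_measurable unif_seq" if "k \<le> n" for k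
      unfolding ilen_def using Suc.IH[OF that] by (intro borel_measurable_diff) blast+
  qed
  have Jn: "?J u \<le> n" for u using max_idx_kakutani_less[of u n] by simp
  have ab: "?a \<in> borel_measurable unif_seq" "?b \<in> borel_measurable unif_seq"
    by (rule nth_at_measurable[OF J Jn], simp add: Suc.IH)+
  have "(\<lambda>u. f (kakutani u (Suc n) ! i)) \<in> borel_measurable unif_seq"
    if f: "f = fst \<or> f = snd" for f
  proof -
    \<comment> \<open>The default 0 keeps \<open>p k\<close> measurable for all \<open>k\<close>, in
      particular for \<open>k = Suc n\<close>, an index that the case distinction below cannot
      select.\<close>
    define p where "p k u = (if k \<le> n then f (kakutani u n ! k) else 0)" for k u
    have [measurable]: "p k \<in> borel_measurable unif_seq" for k
      using Suc.IH[of k] f unfolding p_def by (cases "k \<le> n"; elim disjE; simp only: if_True if_False; simp)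
    define J where "J u = ?J u" for u
    define x where "x u = f (?a u, ?a u + u n * (?b u - ?a u))" for u
    define y where "y u = f (?a u + u n * (?b u - ?a u), ?b u)" for u
    have [measurable]: "J \<in> measurable unif_seq (count_space UNIV)"
      unfolding J_def by (rule J)
    have [measurable]: "x \<in> borel_measurable unif_seq" "y \<in> borel_measurable unif_seq"
      using f ab borel_measurable_add[OF ab(1) borel_measurable_times[OF coord_measurable[of n]
        borel_measurable_diff[OF ab(2,1)]]]
      unfolding x_def y_def by (elim disjE; simp only: fst_conv snd_conv)+
    have "f (kakutani u (Suc n) ! i) =
      (if i < J u then p i u else if i = J u then x u else if i = Suc (J u) then y u else p (i - 1) u)" for u
      using Suc.prems Jn[of u] unfolding kakutani_Suc_nth[OF Suc.prems] p_def J_def x_def y_def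
      by auto
    then have "(\<lambda>u. f (kakutani u (Suc n) ! i)) =
      (\<lambda>u. if i < J u then p i u else if i = J u then x u else if i = Suc (J u) then y u else p (i - 1) u)"
      by (rule ext)
    also have "\<dots> \<in> borel_measurable unif_seq" by measurable
    finally show ?thesis .
  qed
  then show ?case by blast
qed

lemma kak_length_measurable:
  "i \<le> n \<Longrightarrow> (\<lambda>u. ilen (kakutani u n ! i)) \<in> borel_measurable unif_seq"
  unfolding ilen_def using kakutani_nth_measurable[of i n] by (intro borel_measurable_diff) blast+

lemma kak_max_measurable [measurable]: "(\<lambda>u. kak_max u n) \<in> borel_measurable unif_seq"
  unfolding kak_max_def
proof (rule nth_at_measurable)
  show "(\<lambda>u. max_idx (kakutani u n)) \<in> measurable unif_seq (count_space UNIV)"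
    by (rule max_idx_kakutani_measurable) (rule kak_length_measurable)
  show "max_idx (kakutani u n) \<le> n" for u
    using max_idx_kakutani_less[of u n] by simp
qed (rule kak_length_measurable)

lemma kak_dev_measurable [measurable]: "(\<lambda>u. kak_dev u n) \<in> borel_measurable unif_seq"
  unfolding kak_dev_def
  by (intro borel_measurable_diff borel_measurable_divide borel_measurable_const kak_max_measurable)

lemma kak_min_gt_measurable [measurable]: "Measurable.pred unif_seq (\<lambda>u. kak_min u n > d)"
proof -
  have eq: "kak_min u n > d \<longleftrightarrow> (\<forall>i\<in>{..n}. d < ilen (kakutani u n ! i))" for u
    unfolding kak_min_gt_iff by (auto simp: kak_lengths_def all_set_conv_all_nth less_Suc_eq_le)
  show ?thesis unfolding eq
  proof (rule pred_intros_finite)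
    fix i assume "i \<in> {..n}"
    then have [measurable]: "(\<lambda>u. ilen (kakutani u n ! i)) \<in> borel_measurable unif_seq"
      by (simp add: kak_length_measurable)
    show "Measurable.pred unif_seq (\<lambda>u. d < ilen (kakutani u n ! i))" by measurable
  qed simp
qed

lemma frag_score_measurable [measurable]: "frag_score t \<in> borel_measurable borel"
  unfolding frag_score_def[abs_def] by measurable

lemma split_score_measurable [measurable (raw)]:
  assumes [measurable]: "f \<in> borel_measurable N" "g \<in> borel_measurable N"
  shows "(\<lambda>x. split_score t (f x) (g x)) \<in> borel_measurable N"
  unfolding split_score_def by measurable

lemma kak_mart_measurable [measurable]: "(\<lambda>u. kak_mart t u n) \<in> borel_measurable unif_seq"
proof (induction n)
  case (Suc n)
  note Suc [measurable] coord_measurable[of n, measurable]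
  show ?case by simp
qed simp

section \<open>Concentration of the longest interval\<close>

lemma integral_unif01:
  fixes f :: "real \<Rightarrow> real"
  assumes [measurable]: "f \<in> borel_measurable borel"
  shows "(\<integral>v. f v \<partial>unif01) = (\<integral>v. indicator {0..1} v * f v \<partial>lborel)"
  unfolding unif01_eq_density by (subst integral_density) auto

text \<open>Only v \<le> t/m < 1 contributes, and the antiderivative v^2 m/t - v vanishes at both
  ends of [0, t/m]. The second fragment follows by the reflection of \<open>v\<close> to
  \<open>1 - v\<close>.\<close>

lemma frag_score_centred:
  assumes "0 < t" "t < m"
  shows "(\<integral>v. frag_score t (v * m) \<partial>unif01) = 0"
    and "(\<integral>v. frag_score t ((1 - v) * m) \<partial>unif01) = 0"
proof -
  have m: "0 < m" using assms by simp
  have *: "indicator {0..1} v * frag_score t (v * m) = indicator {0..t / m} v *\<^sub>R (2 * v * m / t - 1)" for v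
  proof -
    have "v * m \<le> t \<Longrightarrow> v \<le> 1"
      using assms m mult_strict_right_mono[of 1 v m] by linarith
    then show ?thesis
      using assms m by (auto simp: frag_score_def indicator_def field_simps zero_le_mult_iff)
  qed
  have "(\<integral>v. indicator {0..t / m} v *\<^sub>R (2 * v * m / t - 1) \<partial>lborel)
      = ((t / m)\<^sup>2 * m / t - t / m) - (0\<^sup>2 * m / t - 0)"
    using assms m
    by (intro integral_FTC_atLeastAtMost)
      (auto simp: has_real_derivative_iff_has_vector_derivative[symmetric] intro!: derivative_eq_intros continuous_intros)
  also have "\<dots> = 0" using assms m by (simp add: power2_eq_square)
  finally show A: "(\<integral>v. frag_score t (v * m) \<partial>unif01) = 0"
    by (subst integral_unif01) (simp_all add: *)
  have "(\<integral>v. frag_score t ((1 - v) * m) \<partial>unif01)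
      = (\<integral>v. indicator {0..1} (1 + (-1) * v) * frag_score t ((1 + (-1) * v) * m) \<partial>lborel)"
    by (subst integral_unif01) (auto intro!: Bochner_Integration.integral_cong simp: indicator_def)
  also have "\<dots> = (\<integral>v. indicator {0..1} v * frag_score t (v * m) \<partial>lborel)"
    by (subst (2) lborel_integral_real_affine[where c="-1" and t=1]) auto
  also have "\<dots> = 0" using A by (subst (asm) integral_unif01) auto
  finally show "(\<integral>v. frag_score t ((1 - v) * m) \<partial>unif01) = 0" .
qed

lemma split_score_centred:
  assumes "0 < t"
  shows "(\<integral>v. split_score t m v \<partial>unif01) = 0"
proof (cases "t < m")
  case True
  have "integrable unif01 (\<lambda>v. frag_score t (v * m))" "integrable unif01 (\<lambda>v. frag_score t ((1 - v) * m))"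
    by (rule U.integrable_const_bound[where B=1]; simp add: frag_score_bound assms cong: measurable_cong_sets)+
  then show ?thesis
    using True frag_score_centred[OF assms True] by (simp add: split_score_def)
qed (simp add: split_score_def)

lemma kak_mart_square_integrable:
  assumes "0 < t"
  shows "integrable unif_seq (\<lambda>u. (kak_mart t u n)\<^sup>2)"
proof (rule P.integrable_const_bound[where B="(2 * real n)\<^sup>2"])
  have "(kak_mart t u n)\<^sup>2 \<le> (2 * real n)\<^sup>2" for u
    using kak_mart_bound[OF assms, of u n] by (intro abs_le_square_iff[THEN iffD1]) simp
  then show "AE u in unif_seq. norm ((kak_mart t u n)\<^sup>2) \<le> (2 * real n)\<^sup>2" by simp
qed measurable

text \<open>Orthogonality of martingale increments: the first factor and the maximum depend on
  coordinates below \<open>n\<close>, and integrating out coordinate \<open>n\<close> gives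
  0.\<close>

lemma kak_mart_increment:
  fixes n :: nat
  assumes t: "0 < t"
  defines "X \<equiv> \<lambda>u :: nat \<Rightarrow> real. kak_mart t u n * split_score t (kak_max u n) (u n)"
  shows "integrable unif_seq X" and "(\<integral>u. X u \<partial>unif_seq) = 0"
proof -
  let ?F = "\<lambda>u v. kak_mart t u n * split_score t (kak_max u n) v"
  have bound: "\<bar>?F u v\<bar> \<le> 2 * real n * 2" for u v
    unfolding abs_mult using kak_mart_bound[OF t, of u n] split_score_bound[OF t, of "kak_max u n" v]
    by (intro mult_mono) auto
  have coord: "(\<lambda>u. u n) \<in> borel_measurable unif_seq" by (rule coord_measurable)
  show "integrable unif_seq X"
    unfolding X_def
  proof (rule P.integrable_const_bound[where B="2 * real n * 2"])
    show "(\<lambda>u. ?F u (u n)) \<in> borel_measurable unif_seq"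
      by (intro borel_measurable_times split_score_measurable kak_mart_measurable kak_max_measurable coord)
  qed (simp only: real_norm_def bound eventually_True)
  have "(\<integral>u. X u \<partial>unif_seq) = (\<integral>u. (\<integral>v. ?F u v \<partial>unif01) \<partial>unif_seq)"
    unfolding X_def
  proof (rule expectation_next_coordinate[OF _ bound])
    show "(\<lambda>(u, v). ?F u v) \<in> borel_measurable (unif_seq \<Otimes>\<^sub>M borel)"
      unfolding case_prod_beta'
      by (intro borel_measurable_times split_score_measurable
          measurable_compose[OF measurable_fst kak_mart_measurable]
          measurable_compose[OF measurable_fst kak_max_measurable] measurable_snd)
    show "?F u v = ?F u' v" if "\<And>i. i < n \<Longrightarrow> u i = u' i" for u u' v
      using kak_mart_cong[OF that] kak_max_cong[OF that] by simp
  qed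
  also have "\<dots> = 0" by (simp add: split_score_centred[OF t])
  finally show "(\<integral>u. X u \<partial>unif_seq) = 0" .
qed

text \<open>The cross term has mean zero and each squared increment is at most 4.\<close>

lemma kak_mart_second_moment:
  assumes t: "0 < t"
  shows "(\<integral>u. (kak_mart t u n)\<^sup>2 \<partial>unif_seq) \<le> 4 * real n"
proof (induction n)
  case (Suc n)
  let ?X = "\<lambda>u. kak_mart t u n * split_score t (kak_max u n) (u n)"
  note int = kak_mart_square_integrable[OF t, of n] kak_mart_increment[OF t, of n]
  have "(\<integral>u. (kak_mart t u (Suc n))\<^sup>2 \<partial>unif_seq) \<le> (\<integral>u. ((kak_mart t u n)\<^sup>2 + 2 * ?X u) + 4 \<partial>unif_seq)"
  proof (rule integral_mono)
    fix u
    have "(split_score t (kak_max u n) (u n))\<^sup>2 \<le> 2\<^sup>2"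
      using split_score_bound[OF t] by (intro abs_le_square_iff[THEN iffD1]) simp
    then show "(kak_mart t u (Suc n))\<^sup>2 \<le> (kak_mart t u n)\<^sup>2 + 2 * ?X u + 4"
      by (simp add: power2_sum)
  qed (intro kak_mart_square_integrable[OF t] Bochner_Integration.integrable_add
      integrable_mult_right int P.integrable_const)+
  also have "\<dots> = (\<integral>u. (kak_mart t u n)\<^sup>2 \<partial>unif_seq) + 2 * (\<integral>u. ?X u \<partial>unif_seq) + 4"
    using int(1,2) by (simp add: P.prob_space[simplified])
  finally show ?case using Suc int(3) by simp
qed simp

lemma kak_mart_tail:
  assumes "0 < t" "0 < z"
  shows "P.prob {u. z \<le> \<bar>kak_mart t u n\<bar>} \<le> 4 * real n / z\<^sup>2"
proof -
  have "P.prob {u. z \<le> \<bar>kak_mart t u n\<bar>} \<le> (\<integral>u. (kak_mart t u n)\<^sup>2 \<partial>unif_seq) / z\<^sup>2"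
    using P.second_moment_method[OF kak_mart_measurable kak_mart_square_integrable[OF assms(1)] assms(2)]
    by simp
  also have "\<dots> \<le> 4 * real n / z\<^sup>2"
    by (intro divide_right_mono kak_mart_second_moment assms) simp
  finally show ?thesis .
qed

lemma kak_mart_tail_sets: "{u. z \<le> \<bar>kak_mart t u n\<bar>} \<in> sets unif_seq"
proof -
  have "{u \<in> space unif_seq. z \<le> \<bar>kak_mart t u n\<bar>} \<in> sets unif_seq" by measurable
  then show ?thesis by simp
qed

section \<open>Tails and mean size of the deviation of the longest interval\<close>

lemma kak_dev_upper_tail:
  assumes "1 \<le> k" "0 < z"
  shows "P.prob {u. z < kak_dev u k} \<le> 4 * real k / z\<^sup>2"
proof -
  \<comment> \<open>With this \<open>t\<close> the event says that the maximum is below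
    \<open>t\<close>, and the bound 2/t - 1 - k on the martingale is exactly \<open>z\<close>; k
    \<ge> 1 ensures t < 1.\<close>
  define t where "t = 2 / (z + real (k + 1))"
  have t: "0 < t" "t < 1" "2 / t = z + real (k + 1)"
    using assms by (auto simp: t_def field_simps)
  have "z \<le> \<bar>kak_mart t u k\<bar>" if u: "\<forall>i. 0 \<le> u i \<and> u i \<le> 1" and "z < kak_dev u k" for u
  proof -
    have "2 / t \<le> 2 / kak_max u k" using that t(3) by (simp add: kak_dev_def)
    then have "kak_max u k \<le> t" using t(1) kak_max_pos[of u k] by (simp add: field_simps)
    then have "2 / t - 1 - real k \<le> kak_mart t u k" using kak_mart_dichotomy[OF t(1,2) u] by blast
    then show ?thesis using t(3) by simp
  qed
  then have "P.prob {u. z < kak_dev u k} \<le> P.prob {u. z \<le> \<bar>kak_mart t u k\<bar>}"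
    by (intro P.finite_measure_mono_AE kak_mart_tail_sets) (use AE_unif_seq in \<open>auto elim!: eventually_mono\<close>)
  also have "\<dots> \<le> 4 * real k / z\<^sup>2" by (rule kak_mart_tail) fact+
  finally show ?thesis .
qed

lemma kak_dev_lower_tail:
  assumes "0 < z"
  shows "P.prob {u. kak_dev u k < - z} \<le> 4 * real k / z\<^sup>2"
proof -
  \<comment> \<open>The level with 2/t = k + 1 - z is admissible only if it is below 1. Otherwise
    the event is almost surely empty, because 2/M \<ge> 2 for a longest interval M \<le> 1, and the
    value 1 just keeps \<open>t\<close> positive.\<close>
  define t where "t = (if 2 < real (k + 1) - z then 2 / (real (k + 1) - z) else 1)"
  have t: "0 < t" by (auto simp: t_def)
  have "z \<le> \<bar>kak_mart t u k\<bar>" if u: "\<forall>i. 0 \<le> u i \<and> u i \<le> 1" and "kak_dev u k < - z" for u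
  proof -
    have *: "2 / kak_max u k < real (k + 1) - z" using that by (simp add: kak_dev_def)
    have "2 \<le> 2 / kak_max u k"
      using kak_max_le_1[OF u, of k] kak_max_pos[of u k] by (simp add: field_simps)
    with * have t': "t = 2 / (real (k + 1) - z)" "2 / t = real (k + 1) - z" "t < 1"
      by (auto simp: t_def)
    have "2 / kak_max u k < 2 / t" using * t'(2) by simp
    then have "t < kak_max u k"
      using t kak_max_pos[of u k] by (simp add: field_simps)
    then have "kak_mart t u k \<le> 2 / t - 2 - real k"
      using kak_mart_dichotomy[OF t t'(3) u, of k] frag_scores_kak_le[OF t u] by simp
    then show ?thesis using t'(2) by simp
  qed
  then have "P.prob {u. kak_dev u k < - z} \<le> P.prob {u. z \<le> \<bar>kak_mart t u k\<bar>}"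
    by (intro P.finite_measure_mono_AE kak_mart_tail_sets) (use AE_unif_seq in \<open>auto elim!: eventually_mono\<close>)
  also have "\<dots> \<le> 4 * real k / z\<^sup>2" by (rule kak_mart_tail) fact+
  finally show ?thesis .
qed

lemma kak_dev_tail_sets: "{u. z < \<bar>kak_dev u k\<bar>} \<in> sets unif_seq"
proof -
  have "{u \<in> space unif_seq. z < \<bar>kak_dev u k\<bar>} \<in> sets unif_seq" by measurable
  then show ?thesis by simp
qed

lemma kak_dev_tail:
  assumes "1 \<le> k" "0 < z"
  shows "P.prob {u. z < \<bar>kak_dev u k\<bar>} \<le> 8 * real k / z\<^sup>2"
proof -
  have "{u \<in> space unif_seq. z < kak_dev u k} \<in> sets unif_seq"
    "{u \<in> space unif_seq. kak_dev u k < - z} \<in> sets unif_seq" by measurable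
  moreover have "{u. z < \<bar>kak_dev u k\<bar>} = {u. z < kak_dev u k} \<union> {u. kak_dev u k < - z}"
    by auto
  ultimately have "P.prob {u. z < \<bar>kak_dev u k\<bar>} \<le>
      P.prob {u. z < kak_dev u k} + P.prob {u. kak_dev u k < - z}"
    by (simp add: measure_Un_le)
  then show ?thesis
    using kak_dev_upper_tail[OF assms] kak_dev_lower_tail[OF assms(2), of k] by simp
qed

text \<open>A discrete substitute for integrating the tail: after taking expectations only tail
  probabilities at multiples of \<open>a\<close> enter, and the cutoff \<open>J\<close> keeps the
  sum finite.\<close>

lemma discrete_layer_cake_bound:
  fixes z a :: real
  assumes "0 \<le> a" "z \<le> a * real (J + 1)"
  shows "z \<le> a + a * (\<Sum>j=1..J. of_bool (a * real j < z))"
  using assms(2)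
proof (induction J)
  case (Suc J)
  show ?case
  proof (cases "z \<le> a * real (J + 1)")
    case True
    have "0 \<le> a * of_bool (a * real (Suc J) < z)" using assms(1) by simp
    then show ?thesis using Suc.IH[OF True] by (simp add: distrib_left)
  next
    case False
    have "a * real j < z" if "j \<in> {1..Suc J}" for j
      using False that mult_left_mono[of "real j" "real (J + 1)" a] assms(1) by auto
    then have "(\<Sum>j=1..Suc J. of_bool (a * real j < z)) = (\<Sum>j=1..Suc J. 1 :: real)"
      by (intro sum.cong) auto
    then show ?thesis using Suc.prems by (simp add: algebra_simps)
  qed
qed simp

lemma sum_inverse_squares_le: "(\<Sum>j=1..J. 1 / (real j)\<^sup>2) \<le> 2"
proof -
  \<comment> \<open>The correction 1/J makes the induction work, since 1/(j+1)^2 \<le> 1/j -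
    1/(j+1).\<close>
  have "(\<Sum>j=1..Suc J. 1 / (real j)\<^sup>2) \<le> 2 - 1 / real (Suc J)" for J
  proof (induction J)
    case (Suc J)
    have "1 / (real (Suc (Suc J)))\<^sup>2 \<le> 1 / real (Suc J) - 1 / real (Suc (Suc J))"
      by (simp add: divide_simps power2_eq_square)
    with Suc show ?case by simp
  qed simp
  from this[of "J - 1"] show ?thesis
    by (cases J) (auto intro: order_trans)
qed

lemma integrable_kak_dev: "integrable unif_seq (\<lambda>u. \<bar>kak_dev u k\<bar>)"
  by (rule P.integrable_const_bound[where B="real (k + 1)"]) (use kak_dev_bound in auto)

text \<open>On a grid of width sqrt k, the scale of the standard deviation, the tail at the j-th
  point is at most 8/j^2. This gives the constant 17 = 1 + 8 * 2.\<close>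

lemma expectation_kak_dev:
  assumes k: "1 \<le> k"
  shows "(\<integral>u. \<bar>kak_dev u k\<bar> \<partial>unif_seq) \<le> 17 * sqrt (real k)"
proof -
  define a where "a = sqrt (real k)"
  have a: "1 \<le> a" "a\<^sup>2 = real k" using k by (auto simp: a_def)
  let ?A = "\<lambda>j. {u. a * real j < \<bar>kak_dev u k\<bar>}"
  have int: "integrable unif_seq (indicator (?A j) :: _ \<Rightarrow> real)" for j
    using kak_dev_tail_sets by (intro integrable_real_indicator) (auto simp: P.emeasure_eq_measure)
  have "(\<integral>u. \<bar>kak_dev u k\<bar> \<partial>unif_seq) \<le> (\<integral>u. a + a * (\<Sum>j=1..k. indicator (?A j) u) \<partial>unif_seq)"
  proof (rule integral_mono[OF integrable_kak_dev])
    show "integrable unif_seq (\<lambda>u. a + a * (\<Sum>j=1..k. indicator (?A j) u))"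
      using int by auto
    fix u
    \<comment> \<open>The crude bound k + 1 on the deviation shows that \<open>k\<close> grid points
      suffice.\<close>
    have "1 * real (k + 1) \<le> a * real (k + 1)" using a(1) by (intro mult_right_mono) auto
    then have "\<bar>kak_dev u k\<bar> \<le> a * real (k + 1)" using kak_dev_bound[of u k] by (metis mult_1 order_trans)
    from discrete_layer_cake_bound[OF _ this] show "\<bar>kak_dev u k\<bar> \<le> a + a * (\<Sum>j=1..k. indicator (?A j) u)"
      using a(1) by (simp add: indicator_def of_bool_def)
  qed
  also have "\<dots> = a + a * (\<Sum>j=1..k. P.prob (?A j))"
    using int kak_dev_tail_sets by (simp add: P.prob_space[simplified])
  also have "\<dots> \<le> a + a * (\<Sum>j=1..k. 8 * (1 / (real j)\<^sup>2))"
  proof (intro add_left_mono mult_left_mono sum_mono)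
    fix j assume j: "j \<in> {1..k}"
    then have "P.prob (?A j) \<le> 8 * real k / (a * real j)\<^sup>2"
      using a(1) by (intro kak_dev_tail k) auto
    also have "\<dots> = 8 * (1 / (real j)\<^sup>2)" using k by (simp add: power_mult_distrib a(2))
    finally show "P.prob (?A j) \<le> 8 * (1 / (real j)\<^sup>2)" .
  qed (use a in auto)
  also have "\<dots> \<le> a + a * (8 * 2)"
    unfolding sum_distrib_left[symmetric] using a(1) sum_inverse_squares_le[of k]
    by (intro add_left_mono mult_left_mono) auto
  finally show ?thesis by (simp add: a_def)
qed

section \<open>The survival probability of the shortest interval\<close>

text \<open>The admissible split points form the interval (d/m, 1 - d/m), empty when 2d \<ge> m;
  hence the positive part.\<close>

lemma split_survival_prob:
  assumes "0 \<le> d" "0 < m"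
  shows "(\<integral>v. (if d < v * m \<and> d < (1 - v) * m then 1 else 0) \<partial>unif01) = max 0 (1 - 2 * d / m)"
proof -
  have *: "indicator {0..1} v * (if d < v * m \<and> d < (1 - v) * m then 1 else 0) =
      (indicator {d / m <..< 1 - d / m} v :: real)" for v
  proof -
    have "d < v * m \<longleftrightarrow> d / m < v" "d < (1 - v) * m \<longleftrightarrow> v < 1 - d / m"
      using assms by (auto simp: field_simps)
    moreover have "0 \<le> d / m" using assms by simp
    ultimately show ?thesis by (auto simp: indicator_def)
  qed
  have "(\<integral>v. (if d < v * m \<and> d < (1 - v) * m then 1 else 0 :: real) \<partial>unif01)
      = (\<integral>v. indicator {d / m <..< 1 - d / m} v \<partial>lborel)"
    by (subst integral_unif01) (simp_all add: *)
  also have "\<dots> = max 0 (1 - 2 * d / m)"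
    using assms by (cases "d / m \<le> 1 - d / m") (auto simp: max_def)
  finally show ?thesis .
qed

text \<open>From 1 - p \<le> exp (-p) \<le> 1 - p + p^2; taking the positive part of 1 - y can only
  bring it closer to the positive number exp (-p).\<close>

lemma max_diff_exp_bound:
  fixes p y :: real
  assumes "0 \<le> p"
  shows "\<bar>max 0 (1 - y) - exp (- p)\<bar> \<le> \<bar>y - p\<bar> + p\<^sup>2"
proof -
  \<comment> \<open>The product equals 1 + p^3.\<close>
  have "1 \<le> (1 + p) * (1 - p + p\<^sup>2)"
    using assms by (simp add: algebra_simps power2_eq_square)
  also have "\<dots> \<le> exp p * (1 - p + p\<^sup>2)"
  proof (rule mult_right_mono)
    have "0 \<le> (1 - p)\<^sup>2 + p" using assms by simp
    then show "0 \<le> 1 - p + p\<^sup>2" by (simp add: power2_eq_square algebra_simps)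
  qed simp
  finally have "exp (- p) \<le> 1 - p + p\<^sup>2" by (simp add: exp_minus field_simps)
  moreover have "1 - p \<le> exp (- p)" using exp_ge_add_one_self[of "- p"] by simp
  moreover have "0 < exp (- p)" by simp
  ultimately show ?thesis by (smt (verit) zero_le_power2)
qed

lemma kak_min_cong: "(\<And>i. i < n \<Longrightarrow> u i = v i) \<Longrightarrow> kak_min u n = kak_min v n"
  unfolding kak_min_def kak_lengths_def using kakutani_cong[of n u v] by simp

lemma kak_min_gt_sets: "{u. d < kak_min u n} \<in> sets unif_seq"
  using predE[OF kak_min_gt_measurable[of d n]] by simp

lemma integrable_kak_min_gt:
  "integrable unif_seq (\<lambda>u. of_bool (d < kak_min u n) :: real)"
  "(\<integral>u. of_bool (d < kak_min u n) \<partial>unif_seq) = P.prob {u. d < kak_min u n}"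
proof -
  have eq: "(\<lambda>u. of_bool (d < kak_min u n) :: real) = indicator {u. d < kak_min u n}"
    by (auto simp: indicator_def)
  show "integrable unif_seq (\<lambda>u. of_bool (d < kak_min u n) :: real)"
    unfolding eq by (intro integrable_real_indicator kak_min_gt_sets) (simp add: P.emeasure_eq_measure)
  show "(\<integral>u. of_bool (d < kak_min u n) \<partial>unif_seq) = P.prob {u. d < kak_min u n}"
    unfolding eq by simp
qed

text \<open>Survival up to time \<open>k\<close> and the length to be split depend on earlier
  coordinates only, so integrating out coordinate \<open>k\<close> replaces the split condition by
  its conditional probability.\<close>

lemma survival_recursion:
  assumes d: "0 \<le> d"
  shows "P.prob {u. d < kak_min u (Suc k)} =
    (\<integral>u. of_bool (d < kak_min u k) * max 0 (1 - 2 * d / kak_max u k) \<partial>unif_seq)"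
proof -
  let ?I = "\<lambda>u. of_bool (d < kak_min u k) :: real"
  let ?G = "\<lambda>m v. if d < v * m \<and> d < (1 - v) * m then 1 else 0 :: real"
  have G: "(\<lambda>x. ?G (f x) (g x)) \<in> borel_measurable N"
    if [measurable]: "f \<in> borel_measurable N" "g \<in> borel_measurable N"
    for f g and N :: "((nat \<Rightarrow> real) \<times> real) measure"
    by measurable
  have "P.prob {u. d < kak_min u (Suc k)} = (\<integral>u. of_bool (d < kak_min u (Suc k)) \<partial>unif_seq)"
    by (simp only: integrable_kak_min_gt)
  also have "\<dots> = (\<integral>u. ?I u * ?G (kak_max u k) (u k) \<partial>unif_seq)"
    by (intro Bochner_Integration.integral_cong refl) (simp add: kak_min_gt_Suc[OF d])
  also have "\<dots> = (\<integral>u. (\<integral>v. ?I u * ?G (kak_max u k) v \<partial>unif01) \<partial>unif_seq)"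
  proof (rule expectation_next_coordinate[where B=1])
    show "(\<lambda>(u, v). ?I u * ?G (kak_max u k) v) \<in> borel_measurable (unif_seq \<Otimes>\<^sub>M borel)"
      unfolding case_prod_beta'
      by (intro borel_measurable_times G measurable_snd
          measurable_compose[OF measurable_fst kak_max_measurable]
          measurable_compose[OF measurable_fst borel_measurable_integrable[OF integrable_kak_min_gt(1)]])
    show "?I u * ?G (kak_max u k) v = ?I u' * ?G (kak_max u' k) v"
      if "\<And>i. i < k \<Longrightarrow> u i = u' i" for u u' v
      using kak_min_cong[OF that] kak_max_cong[OF that] by simp
  qed simp
  also have "\<dots> = (\<integral>u. ?I u * max 0 (1 - 2 * d / kak_max u k) \<partial>unif_seq)"
    by (simp only: integral_mult_right_zero split_survival_prob[OF d kak_max_pos])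
  finally show ?thesis .
qed

text \<open>Centring at k + 1/2 makes the values of \<open>p\<close> for k < n add up to exactly d
  n^2/2. The shift from k + 1 costs d/2, and p^2 is the cost of the exponential.\<close>

lemma survival_step:
  fixes k :: nat
  assumes d: "0 \<le> d"
  defines "p \<equiv> d * (real k + 1 / 2)"
  shows "\<bar>P.prob {u. d < kak_min u (Suc k)} - exp (- p) * P.prob {u. d < kak_min u k}\<bar>
    \<le> d * (\<integral>u. \<bar>kak_dev u k\<bar> \<partial>unif_seq) + d / 2 + p\<^sup>2"
proof -
  let ?I = "\<lambda>u. of_bool (d < kak_min u k) :: real"
  let ?s = "\<lambda>u. max 0 (1 - 2 * d / kak_max u k)"
  have p: "0 \<le> p" using d by (simp add: p_def)
  note I = integrable_kak_min_gt[of d k]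
  have Is: "integrable unif_seq (\<lambda>u. ?I u * ?s u)"
  proof (rule P.integrable_const_bound[where B=1])
    have "\<bar>?I u * ?s u\<bar> \<le> 1" for u
    proof -
      have "0 \<le> 2 * d / kak_max u k" using d kak_max_pos[of u k] by simp
      then show ?thesis by (simp add: max_def)
    qed
    then show "AE u in unif_seq. norm (?I u * ?s u) \<le> 1"
      by (intro AE_I2) (simp only: real_norm_def)
    show "(\<lambda>u. ?I u * ?s u) \<in> borel_measurable unif_seq"
      by (intro borel_measurable_times borel_measurable_max borel_measurable_diff borel_measurable_divide
          borel_measurable_const kak_max_measurable borel_measurable_integrable[OF I(1)])
  qed
  have eq: "P.prob {u. d < kak_min u (Suc k)} - exp (- p) * P.prob {u. d < kak_min u k}
      = (\<integral>u. ?I u * ?s u - exp (- p) * ?I u \<partial>unif_seq)"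
    unfolding survival_recursion[OF d] I(2)[symmetric]
    by (simp only: Bochner_Integration.integral_diff[OF Is integrable_mult_right[OF I(1)]]
        integral_mult_right_zero)
  have "\<bar>\<integral>u. ?I u * ?s u - exp (- p) * ?I u \<partial>unif_seq\<bar> \<le> (\<integral>u. \<bar>?I u * ?s u - exp (- p) * ?I u\<bar> \<partial>unif_seq)"
    by (rule integral_abs_bound)
  also have "\<dots> \<le> (\<integral>u. d * \<bar>kak_dev u k\<bar> + (d / 2 + p\<^sup>2) \<partial>unif_seq)"
  proof (rule integral_mono)
    show "integrable unif_seq (\<lambda>u. \<bar>?I u * ?s u - exp (- p) * ?I u\<bar>)"
      by (intro integrable_abs Bochner_Integration.integrable_diff integrable_mult_right Is I(1))
    show "integrable unif_seq (\<lambda>u. d * \<bar>kak_dev u k\<bar> + (d / 2 + p\<^sup>2))"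
      by (intro Bochner_Integration.integrable_add integrable_mult_right integrable_kak_dev P.integrable_const)
    fix u
    have "2 * d / kak_max u k - p = d * kak_dev u k + d / 2"
      by (simp add: kak_dev_def p_def ring_distribs)
    moreover have "\<bar>d * kak_dev u k\<bar> = d * \<bar>kak_dev u k\<bar>" "\<bar>d / 2\<bar> = d / 2"
      using d by (simp_all add: abs_mult)
    ultimately have "\<bar>2 * d / kak_max u k - p\<bar> \<le> d * \<bar>kak_dev u k\<bar> + d / 2"
      by (metis abs_triangle_ineq)
    then have "\<bar>2 * d / kak_max u k - p\<bar> + p\<^sup>2 \<le> d * \<bar>kak_dev u k\<bar> + (d / 2 + p\<^sup>2)"
      by (simp only: add.assoc[symmetric] add_le_cancel_right)
    with max_diff_exp_bound[OF p]
    have "\<bar>?s u - exp (- p)\<bar> \<le> d * \<bar>kak_dev u k\<bar> + (d / 2 + p\<^sup>2)"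
      by (rule order_trans)
    moreover have "0 \<le> d * \<bar>kak_dev u k\<bar> + (d / 2 + p\<^sup>2)" using d by simp
    ultimately show "\<bar>?I u * ?s u - exp (- p) * ?I u\<bar> \<le> d * \<bar>kak_dev u k\<bar> + (d / 2 + p\<^sup>2)"
      by (cases "d < kak_min u k") (simp_all only: of_bool_eq mult_1 mult_1_right mult_zero_left
        mult_zero_right diff_self abs_zero)
  qed
  also have "\<dots> = d * (\<integral>u. \<bar>kak_dev u k\<bar> \<partial>unif_seq) + d / 2 + p\<^sup>2"
    using integrable_kak_dev[of k] by (simp add: P.prob_space[simplified])
  finally show ?thesis unfolding eq .
qed

text \<open>The error inherited from time \<open>n\<close> is multiplied by exp (-p) \<le> 1, so
  one-step errors merely add up. The induction starts from d < 1, the length of the initial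
  interval.\<close>

lemma survival_telescope:
  assumes d: "0 \<le> d" "d < 1"
  shows "\<bar>P.prob {u. d < kak_min u n} - exp (- (d * (real n)\<^sup>2 / 2))\<bar>
    \<le> (\<Sum>k<n. d * (\<integral>u. \<bar>kak_dev u k\<bar> \<partial>unif_seq) + d / 2 + (d * (real k + 1 / 2))\<^sup>2)"
proof (induction n)
  case 0
  have "kak_min u 0 = 1" for u by (simp add: kak_min_def)
  then show ?case using d P.prob_space by simp
next
  case (Suc n)
  let ?a = "\<lambda>n. P.prob {u. d < kak_min u n}" and ?p = "d * (real n + 1 / 2)"
  have e: "exp (- (d * (real (Suc n))\<^sup>2 / 2)) = exp (- ?p) * exp (- (d * (real n)\<^sup>2 / 2))"
    unfolding exp_add[symmetric] by (rule arg_cong[where f=exp]) (simp add: power2_eq_square field_simps)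
  have "?a (Suc n) - exp (- (d * (real (Suc n))\<^sup>2 / 2)) =
      (?a (Suc n) - exp (- ?p) * ?a n) + exp (- ?p) * (?a n - exp (- (d * (real n)\<^sup>2 / 2)))"
    unfolding e by (simp add: algebra_simps)
  then have "\<bar>?a (Suc n) - exp (- (d * (real (Suc n))\<^sup>2 / 2))\<bar> \<le>
      \<bar>?a (Suc n) - exp (- ?p) * ?a n\<bar> + exp (- ?p) * \<bar>?a n - exp (- (d * (real n)\<^sup>2 / 2))\<bar>"
    by (metis abs_exp_cancel abs_mult abs_triangle_ineq)
  also have "exp (- ?p) * \<bar>?a n - exp (- (d * (real n)\<^sup>2 / 2))\<bar> \<le> \<bar>?a n - exp (- (d * (real n)\<^sup>2 / 2))\<bar>"
    using d by (intro mult_left_le_one_le) auto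
  finally show ?case using Suc survival_step[OF d(1), of n] by simp
qed

lemma survival_bound:
  assumes n: "1 \<le> n" and d: "0 \<le> d" "d < 1"
  shows "\<bar>P.prob {u. d < kak_min u n} - exp (- (d * (real n)\<^sup>2 / 2))\<bar>
    \<le> real n * (18 * d * sqrt (real n) + (d * real n)\<^sup>2)"
proof -
  have s: "1 \<le> sqrt (real n)" using n by simp
  have "d * (\<integral>u. \<bar>kak_dev u k\<bar> \<partial>unif_seq) + d / 2 + (d * (real k + 1 / 2))\<^sup>2
      \<le> 18 * d * sqrt (real n) + (d * real n)\<^sup>2" if "k \<in> {..<n}" for k
  proof -
    have "(\<integral>u. \<bar>kak_dev u k\<bar> \<partial>unif_seq) \<le> 17 * sqrt (real n)"
    \<comment> \<open>The moment bound needs k \<ge> 1; at k = 0 the deviation is at most 1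
      anyway.\<close>
    proof (cases "k = 0")
      case True
      have "(\<integral>u. \<bar>kak_dev u k\<bar> \<partial>unif_seq) \<le> (\<integral>u. 1 \<partial>unif_seq)"
        using kak_dev_bound[of _ k] True
        by (intro integral_mono integrable_kak_dev P.integrable_const) simp
      then have "(\<integral>u. \<bar>kak_dev u k\<bar> \<partial>unif_seq) \<le> 1" by (simp add: P.prob_space[simplified])
      then show ?thesis using s by linarith
    next
      case False
      then have "(\<integral>u. \<bar>kak_dev u k\<bar> \<partial>unif_seq) \<le> 17 * sqrt (real k)"
        by (intro expectation_kak_dev) simp
      also have "\<dots> \<le> 17 * sqrt (real n)" using that by simp
      finally show ?thesis .
    qed
    then have "d * (\<integral>u. \<bar>kak_dev u k\<bar> \<partial>unif_seq) \<le> d * (17 * sqrt (real n))"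
      using d by (intro mult_left_mono)
    \<comment> \<open>This absorbs d/2 and raises the constant from 17 to 18.\<close>
    moreover have "d * 1 \<le> d * sqrt (real n)" using s d by (intro mult_left_mono)
    moreover have "(d * (real k + 1 / 2))\<^sup>2 \<le> (d * real n)\<^sup>2"
      using that d by (intro power_mono mult_left_mono) auto
    ultimately show ?thesis using d by linarith
  qed
  then have "(\<Sum>k<n. d * (\<integral>u. \<bar>kak_dev u k\<bar> \<partial>unif_seq) + d / 2 + (d * (real k + 1 / 2))\<^sup>2)
      \<le> (\<Sum>k<n. 18 * d * sqrt (real n) + (d * real n)\<^sup>2)"
    by (rule sum_mono)
  also have "\<dots> = real n * (18 * d * sqrt (real n) + (d * real n)\<^sup>2)" by simp
  finally show ?thesis using survival_telescope[OF d, of n] by linarith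
qed

section \<open>Rescaling to the exponential limit\<close>

lemma scaled_survival_bound:
  assumes n: "1 \<le> n" and x: "0 \<le> x" "x \<le> ln (real n)"
  shows "\<bar>P.prob {u. real n ^ 2 * kak_min u n / 2 > x} - exp (- x)\<bar> \<le> 44 * ln (real n) / sqrt (real n)"
proof -
  define d where "d = 2 * x / (real n)\<^sup>2"
  define r where "r = sqrt (real n)"
  have r: "1 \<le> r" "real n = r\<^sup>2" using n by (auto simp: r_def)
  have "x \<le> real n - 1" using x ln_le_minus_one[of "real n"] n by linarith
  moreover have "2 * (real n - 1) < (real n)\<^sup>2"
    using zero_le_power2[of "real n - 1"] by (simp add: power2_eq_square algebra_simps)
  ultimately have d: "0 \<le> d" "d < 1" using x n by (auto simp: d_def divide_simps)
  \<comment> \<open>The bound x \<le> 2r reduces the quadratic error 4x^2/r^2 to 8x/r, so that 36 +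
    8 = 44.\<close>
  have "ln (real n) = 2 * ln r" using r by (simp add: ln_realpow)
  moreover have "ln r \<le> r - 1" using r by (intro ln_le_minus_one) simp
  ultimately have xr: "x \<le> 2 * r" using x by linarith
  have "(real n ^ 2 * kak_min u n / 2 > x) = (d < kak_min u n)" for u
    using n by (simp add: d_def field_simps)
  then have "\<bar>P.prob {u. real n ^ 2 * kak_min u n / 2 > x} - exp (- x)\<bar>
      = \<bar>P.prob {u. d < kak_min u n} - exp (- (d * (real n)\<^sup>2 / 2))\<bar>"
    using n by (simp add: d_def)
  also have "\<dots> \<le> real n * (18 * d * sqrt (real n) + (d * real n)\<^sup>2)"
    by (rule survival_bound[OF n d])
  also have "\<dots> = 36 * x / r + 4 * x * x / r\<^sup>2"
    unfolding d_def r_def[symmetric] r(2) using r(1) by (simp add: field_simps power2_eq_square)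
  also have "4 * x * x / r\<^sup>2 \<le> 4 * x * (2 * r) / r\<^sup>2"
    using x xr by (intro divide_right_mono mult_left_mono) auto
  also have "36 * x / r + 4 * x * (2 * r) / r\<^sup>2 = 44 * x / r"
    using r(1) by (simp add: field_simps power2_eq_square)
  also have "\<dots> \<le> 44 * ln (real n) / r" using x r by (intro divide_right_mono) auto
  finally show ?thesis by (simp add: r_def)
qed

theorem theorem1p4:
  "\<exists>C::real. C \<ge> 0 \<and> (\<forall>n::nat. n \<ge> 1 \<longrightarrow>
     (\<forall>x::real. x \<ge> 0 \<longrightarrow>
        \<bar>measure unif_seq {u \<in> space unif_seq. real n ^ 2 * kak_min u n / 2 > x} - exp (- x)\<bar>
          \<le> C * (1 + ln (real n)) / sqrt (real n)))"
proof (intro exI[of _ 44] conjI allI impI)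
  fix n :: nat and x :: real
  assume n: "1 \<le> n" and x: "0 \<le> x"
  let ?Q = "\<lambda>x. {u. real n ^ 2 * kak_min u n / 2 > x}" and ?l = "ln (real n)"
  have l: "0 \<le> ?l" using n by simp
  have C: "44 * ?l / sqrt (real n) + 1 / sqrt (real n) \<le> 44 * (1 + ?l) / sqrt (real n)"
    using n by (simp add: field_simps)
  have s: "0 < sqrt (real n)" using n by simp
  have "\<bar>P.prob (?Q x) - exp (- x)\<bar> \<le> 44 * (1 + ?l) / sqrt (real n)"
  proof (cases "x \<le> ?l")
    case True
    then show ?thesis using scaled_survival_bound[OF n x True] C s by (smt (verit) divide_pos_pos)
  next
    case False
    \<comment> \<open>Beyond ln n both the probability and exp (-x) are nonnegative and decreasing
      in \<open>x\<close>, so their difference is controlled by their values at ln n, where the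
      exponential is 1/n \<le> 1/sqrt n.\<close>
    have "sqrt (real n) \<le> real n" using n self_le_power[of "real n" 2] by (intro real_le_lsqrt) auto
    then have "1 / real n \<le> 1 / sqrt (real n)" using s n by (intro divide_left_mono) auto
    then have el: "exp (- ?l) \<le> 1 / sqrt (real n)" using n by (simp add: exp_minus inverse_eq_divide)
    have "{u. 2 * ?l / (real n)\<^sup>2 < kak_min u n} = ?Q ?l" using n by (auto simp: field_simps)
    then have "?Q ?l \<in> sets unif_seq" using kak_min_gt_sets by metis
    then have "P.prob (?Q x) \<le> P.prob (?Q ?l)"
      using False by (intro P.finite_measure_mono) auto
    moreover have "P.prob (?Q ?l) \<le> exp (- ?l) + 44 * ?l / sqrt (real n)"
      using scaled_survival_bound[OF n l order_refl] by linarith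
    moreover have "exp (- x) \<le> exp (- ?l)" using False by simp
    moreover have "0 \<le> 44 * ?l / sqrt (real n)" using l s by simp
    ultimately show ?thesis
      using C el measure_nonneg[of unif_seq "?Q x"] exp_gt_zero[of "- x"] by linarith
  qed
  then show "\<bar>measure unif_seq {u \<in> space unif_seq. real n ^ 2 * kak_min u n / 2 > x} - exp (- x)\<bar>
      \<le> 44 * (1 + ln (real n)) / sqrt (real n)" by simp
qed simp

end
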